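(* Let $\tilde{F}(\lambda,t)=\sum_{g\ge 0}\lambda^{2g-2}\tilde{F}^g(t)$ be the contribution of the non-constant maps to the Gromov-Witten potential of the resolved conifold, i.e. with $q=\exp(2\pi i t)$, $$\tilde{F}^0(t)=\mathrm{Li}_3(q),\qquad \tilde{F}^g(t)=\frac{(-1)^{g-1}B_{2g}}{2g\,(2g-2)!}\,\mathrm{Li}_{3-2g}(q)\quad (g\ge 1).$$ Then $\tilde{F}$ satisfies the difference equation $$\tilde{F}(\lambda,t+\check{\lambda})-2\tilde{F}(\lambda,t)+\tilde{F}(\lambda,t-\check{\lambda})=\left(\frac{1}{2\pi}\frac{\partial}{\partial t}\right)^2\tilde{F}^0(t),\qquad \check{\lambda}=\frac{\lambda}{2\pi}.$$
   Context: The resolved conifold is the Calabi-Yau threefold given by the total space of $\mathcal{O}(-1)\oplus\mathcal{O}(-1)\to\mathbb{P}^1$. The Gromov-Witten (GW) potential of a Calabi-Yau threefold $X$ is the formal power series $F(\lambda,t)=\sum_{g\ge0}\lambda^{2g-2}\sum_{\beta\in H_2(X,\mathbb{Z})}N^g_\beta q^\beta$, with $N^g_\beta$ the GW invariants and $q^\beta=\exp(2\pi i t^\beta)$; one writes $F=F_{\beta=0}+\tilde{F}$, where $\tilde{F}$ is the contribution of non-constant maps. For the resolved conifold there is a single variable $t$ with $q=\exp(2\pi i t)$, and the coefficients $\tilde{F}^g$ of $\tilde{F}$ are known to be the expressions given in the claim; these expressions may be taken as the definition of $\tilde{F}$. Here $\mathrm{Li}_s(z)=\sum_{n=1}^\infty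 z^n/n^s$ is the polylogarithm, and the $B_n$ are the Bernoulli numbers, $\frac{w}{e^w-1}=\sum_{n\ge0}B_n\frac{w^n}{n!}$. The variable $\lambda$ is a formal parameter: $\tilde{F}$ is a formal Laurent series in $\lambda$ with coefficients depending on $t$ (through power series in $q$), and the shifts $t\mapsto t\pm\check{\lambda}$ are understood by formal Taylor expansion, $f(t\pm\check{\lambda})=e^{\pm\check{\lambda}\partial_t}f(t)$, applied to each coefficient. The identity is one of formal Laurent series in $\lambda$. *)

theory Defs
  imports "HOL-Analysis.Analysis" "HOL-Library.Function_Algebras"
    "HOL-Computational_Algebra.Formal_Laurent_Series"
begin

(* The exponential generating function of the Bernoulli numbers is w / (e^w - 1),
   so the first Bernoulli number is -1/2. *)
definition bernoulli :: "nat \<Rightarrow> real" where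
  "bernoulli n = fact n * fps_nth (fps_X / (fps_exp 1 - 1)) n"

lemma bernoulli_egf:
  "(fps_exp 1 - 1) * Abs_fps (\<lambda>n. bernoulli n / fact n) = fps_X"
proof -
  have A: "Abs_fps (\<lambda>n. bernoulli n / fact n) = fps_X / (fps_exp 1 - 1)"
    by (simp add: fps_eq_iff bernoulli_def)
  have ne: "fps_exp 1 - 1 \<noteq> (0 :: real fps)"
    by (auto simp: fps_eq_iff intro!: exI[of _ 1])
  have "subdegree (fps_exp 1 - 1 :: real fps) = 1"
    by (rule subdegreeI) auto
  then have "fps_exp 1 - 1 dvd (fps_X :: real fps)"
    using ne by (subst fps_dvd_iff) auto
  then show ?thesis by (simp add: A)
qed

(* Used only for |z| < 1, where the series converges for every integer s. *)
definition polylog :: "int \<Rightarrow> complex \<Rightarrow> complex" where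
  "polylog s z = (\<Sum>n. z ^ Suc n / of_nat (Suc n) powi s)"

definition GW_coeff :: "nat \<Rightarrow> complex \<Rightarrow> complex" where
  "GW_coeff g t =
     (let q = exp (2 * of_real pi * \<i> * t) in
      if g = 0 then polylog 3 q
      else of_real ((-1) ^ (g - 1) * bernoulli (2 * g) / (real (2 * g) * fact (2 * g - 2)))
             * polylog (3 - 2 * int g) q)"

(* Formal Laurent series in lambda whose coefficients are functions of t. *)
definition GW_potential :: "(complex \<Rightarrow> complex) fls" where
  "GW_potential =
     fls_shift 2 (fps_to_fls (Abs_fps (\<lambda>m. if even m then GW_coeff (m div 2) else 0)))"

lemma GW_potential_nth:
  "fls_nth GW_potential (2 * int g - 2) = GW_coeff g"
  "odd n \<Longrightarrow> fls_nth GW_potential n = 0"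
  "n < -2 \<Longrightarrow> fls_nth GW_potential n = 0"
  by (auto simp: GW_potential_def nat_mult_distrib even_nat_iff)

(* The substitution t \<mapsto> t + c lambda: exp (c lambda d/dt) applied to each coefficient,
   so that lambda^m collects c^k / k! times the k-th t-derivative of the coefficient of
   lambda^(m-k). Only finitely many k contribute, as the principal part is finite. *)
definition taylor_shift :: "complex \<Rightarrow> (complex \<Rightarrow> complex) fls \<Rightarrow> (complex \<Rightarrow> complex) fls" where
  "taylor_shift c F =
     Abs_fls (\<lambda>m t. \<Sum>k | fls_nth F (m - int k) \<noteq> 0.
                       c ^ k / fact k * (deriv ^^ k) (fls_nth F (m - int k)) t)"

lemma finite_taylor_shift: "finite {k. fls_nth F (m - int k) \<noteq> 0}"
proof -
  obtain N where N: "\<forall>n<N. fls_nth F n = 0"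
    by (rule fls_nth_vanishes_belowE)
  have "k \<le> nat (m - N)" if "fls_nth F (m - int k) \<noteq> 0" for k
  proof -
    have "\<not> m - int k < N" using N that by blast
    then show ?thesis by linarith
  qed
  then show ?thesis by (intro finite_subset[OF _ finite_atMost[of "nat (m - N)"]]) auto
qed

lemma taylor_shift_nth:
  "fls_nth (taylor_shift c F) m =
     (\<lambda>t. \<Sum>k | fls_nth F (m - int k) \<noteq> 0.
            c ^ k / fact k * (deriv ^^ k) (fls_nth F (m - int k)) t)"
proof -
  obtain N where N: "\<forall>n<N. fls_nth F n = 0"
    by (rule fls_nth_vanishes_belowE)
  then have "\<forall>n<N. {k. fls_nth F (n - int k) \<noteq> 0} = {}"
    by auto
  then show ?thesis
    unfolding taylor_shift_def
    by (intro nth_Abs_fls_ex_lower_bound exI[of _ N]) (auto simp: zero_fun_def)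
qed

end

theory Submission
  imports Defs
begin

text \<open>
  On the upper half plane every coefficient of the potential is a multiple of a polylogarithm
  \<open>Li\<^sub>s(q)\<close>, and \<open>\<partial>\<^sub>t\<close> acts on these by \<open>\<partial>\<^sub>t Li\<^sub>s(q) = 2\<pi>\<i> Li\<^bsub>s-1\<^esub>(q)\<close>
  (lemma \<open>funpow_deriv_polylog_exp\<close>). The coefficient of \<open>\<lambda>\<^bsup>N-2\<^esup>\<close> carries \<open>Li\<^bsub>3-N\<^esub>\<close>, so the
  weight drops by one with each power of \<open>\<lambda>\<close>, which is exactly what one \<open>t\<close>-derivative does.
  Hence all the terms that a shift contributes to \<open>\<lambda>\<^bsup>N-2\<^esup>\<close> are multiples of the same function
  \<open>Li\<^bsub>3-N\<^esub>(q)\<close>, and the shift \<open>exp (c\<lambda>\<partial>\<^sub>t)\<close> reduces to multiplication of the numerical series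
  \<open>A(\<lambda>) = \<Sum>\<^sub>g a\<^sub>g \<lambda>\<^bsup>2g\<^esup>\<close> by \<open>exp (2\<pi>\<i>c\<lambda>)\<close> (lemma \<open>taylor_shift_GW_potential_nth\<close>).

  For \<open>c = \<plusminus>1/(2\<pi>)\<close> the difference operator therefore becomes multiplication by
  \<open>exp (\<i>\<lambda>) - 2 + exp (-\<i>\<lambda>) = - (2 sin (\<lambda>/2))\<^sup>2\<close>. The Bernoulli numbers enter \<open>A\<close> in such a way
  that \<open>A(\<lambda>) = (\<lambda> / (2 sin (\<lambda>/2)))\<^sup>2\<close>, so the product is just \<open>-\<lambda>\<^sup>2\<close> (lemma
  \<open>gw_series_functional_equation\<close>). What survives is the single term \<open>-Li\<^sub>1(q)\<close> in
  degree \<open>N = 2\<close>, that is at \<open>\<lambda>\<^sup>0\<close>, and this is \<open>((1/2\<pi>)\<partial>\<^sub>t)\<^sup>2 Li\<^sub>3(q)\<close>.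
\<close>

section \<open>The Bernoulli generating function\<close>

definition bernoulli_fps :: "complex fps" where
  "bernoulli_fps = Abs_fps (\<lambda>n. of_real (bernoulli n / fact n))"

lemma bernoulli_fps_egf: "(fps_exp 1 - 1) * bernoulli_fps = fps_X"
proof (rule fps_ext)
  fix n
  have "fps_nth ((fps_exp 1 - 1) * bernoulli_fps) n =
        of_real (fps_nth ((fps_exp 1 - 1) * Abs_fps (\<lambda>n. bernoulli n / fact n)) n)"
    unfolding bernoulli_fps_def fps_mult_nth of_real_sum
    by (intro sum.cong) (auto simp: fps_one_nth)
  then show "fps_nth ((fps_exp 1 - 1) * bernoulli_fps) n = fps_nth fps_X n"
    by (simp add: bernoulli_egf fps_X_def)
qed

text \<open>
  Up to sign, the numerical coefficients of the potential are \<open>(n - 1) B\<^sub>n / n!\<close> with \<open>n = 2g\<close>.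
  These belong to \<open>w b' - b\<close>, where \<open>b = w / (e\<^sup>w - 1)\<close>. The value of this series,
  \<open>- w\<^sup>2 e\<^sup>w / (e\<^sup>w - 1)\<^sup>2\<close>, comes from differentiating \<open>(e\<^sup>w - 1) b = w\<close>.
\<close>

definition bernoulli_euler_fps :: "complex fps" where
  "bernoulli_euler_fps = fps_X * fps_deriv bernoulli_fps - bernoulli_fps"

lemma bernoulli_euler_fps_nth:
  "fps_nth bernoulli_euler_fps n = (of_nat n - 1) * of_real (bernoulli n / fact n)"
  by (cases n) (simp_all add: bernoulli_euler_fps_def bernoulli_fps_def
    algebra_simps add_divide_distrib)

lemma second_difference_bernoulli_euler_fps:
  "(fps_exp 1 + fps_exp (-1) - 2) * bernoulli_euler_fps = - (fps_X ^ 2)"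
proof -
  define E where "E = (fps_exp 1 :: complex fps)"
  define E' where "E' = (fps_exp (-1) :: complex fps)"
  define b where "b = bernoulli_fps"
  define b' where "b' = fps_deriv bernoulli_fps"
  have inv: "E * E' = 1"
    by (simp add: E_def E'_def flip: fps_exp_add_mult)
  have egf: "(E - 1) * b = fps_X"
    using bernoulli_fps_egf by (simp add: E_def b_def)
  have "fps_deriv ((E - 1) * b) = 1"
    by (simp add: egf)
  then have deriv: "(E - 1) * b' + E * b = 1"
    by (simp add: E_def b_def b'_def)
  have "(E - 1) ^ 2 * (fps_X * b' - b) =
        (E - 1) * (fps_X * ((E - 1) * b')) - (E - 1) * ((E - 1) * b)"
    by (simp add: algebra_simps power2_eq_square)
  also have "\<dots> = (E - 1) * (fps_X * (1 - E * b)) - (E - 1) * fps_X"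
    using deriv by (simp only: egf) algebra
  also have "\<dots> = - (fps_X * E * ((E - 1) * b))"
    by (simp add: algebra_simps)
  finally have sq: "(E - 1) ^ 2 * (fps_X * b' - b) = - (E * fps_X ^ 2)"
    by (simp only: egf) (simp add: power2_eq_square mult_ac)
  \<comment> \<open>In other words \<open>e\<^sup>w - 2 + e\<^bsup>-w\<^esup> = (e\<^bsup>w/2\<^esup> - e\<^bsup>-w/2\<^esup>)\<^sup>2\<close>, which cancels the denominator.\<close>
  have "E + E' - 2 = E' * (E - 1) ^ 2"
    using inv by algebra
  then have "(E + E' - 2) * (fps_X * b' - b) = E' * ((E - 1) ^ 2 * (fps_X * b' - b))"
    by (simp add: mult_ac)
  also have "\<dots> = - ((E * E') * fps_X ^ 2)"
    unfolding sq by (simp add: mult_ac)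
  also have "\<dots> = - (fps_X ^ 2)"
    unfolding inv by simp
  finally show ?thesis
    by (simp add: bernoulli_euler_fps_def E_def E'_def b_def b'_def)
qed

text \<open>
  The substitution \<open>w = \<i>\<lambda>\<close> together with the overall minus sign produces the signs
  \<open>(-1)\<^bsup>g-1\<^esup> = -\<i>\<^bsup>2g\<^esup>\<close> of the potential. The result is the expansion of
  \<open>(\<lambda> / (2 sin (\<lambda>/2)))\<^sup>2\<close>.
\<close>

definition gw_series :: "complex fps" where
  "gw_series = - (bernoulli_euler_fps oo (fps_const \<i> * fps_X))"

lemma gw_series_nth:
  "fps_nth gw_series n = - (\<i> ^ n * (of_nat n - 1) * of_real (bernoulli n / fact n))"
  by (simp add: gw_series_def fps_compose_linear bernoulli_euler_fps_nth)

lemma gw_series_functional_equation: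
  "(fps_exp \<i> + fps_exp (- \<i>) - 2) * gw_series = - (fps_X ^ 2)"
proof -
  define L where "L = fps_const \<i> * (fps_X :: complex fps)"
  have L0: "fps_nth L 0 = 0" by (simp add: L_def)
  have exp_L: "fps_exp c oo L = fps_exp (c * \<i>)" for c
    by (simp add: L_def fps_exp_compose_linear)
  have two_L: "2 oo L = 2"
    by (metis fps_const_compose numeral_fps_const)
  have X2_L: "fps_X ^ 2 oo L = - (fps_X ^ 2)"
    unfolding power2_eq_square fps_compose_mult_distrib[OF L0]
    by (simp add: fps_X_fps_compose_startby0 L0) (simp add: L_def fps_eq_iff mult_ac)
  have "((fps_exp 1 + fps_exp (-1) - 2) * bernoulli_euler_fps) oo L = - (fps_X ^ 2) oo L"
    by (simp only: second_difference_bernoulli_euler_fps)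
  then show ?thesis
    using L0
    by (simp add: fps_compose_mult_distrib fps_compose_add_distrib fps_compose_sub_distrib
          fps_compose_uminus exp_L two_L X2_L gw_series_def flip: L_def)
qed

text \<open>
  Both \<open>exp (\<i>\<lambda>) + exp (-\<i>\<lambda>) - 2\<close> and \<open>-\<lambda>\<^sup>2\<close> are even, hence so is their quotient. In terms of
  Bernoulli numbers this is the vanishing of \<open>B\<^sub>3, B\<^sub>5, \<dots>\<close>; the exceptional \<open>B\<^sub>1\<close> is removed by
  the factor \<open>n - 1\<close>.
\<close>

lemma gw_series_odd:
  assumes "odd n"
  shows "fps_nth gw_series n = 0"
proof -
  define M where "M = fps_const (-1) * (fps_X :: complex fps)"
  define C where "C = (fps_exp \<i> + fps_exp (- \<i>) - 2 :: complex fps)"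
  have M0: "fps_nth M 0 = 0" by (simp add: M_def)
  have exp_M: "fps_exp c oo M = fps_exp (- c)" for c
    by (simp add: M_def fps_exp_compose_linear del: fps_const_neg)
  have two_M: "2 oo M = 2"
    by (metis fps_const_compose numeral_fps_const)
  have C_M: "C oo M = C"
    by (simp add: C_def fps_compose_add_distrib fps_compose_sub_distrib exp_M two_M)
  have X2_M: "fps_X ^ 2 oo M = fps_X ^ 2"
    unfolding power2_eq_square fps_compose_mult_distrib[OF M0]
    by (simp add: fps_X_fps_compose_startby0 M0) (simp add: M_def)
  have CA: "C * gw_series = - (fps_X ^ 2)"
    using gw_series_functional_equation by (simp add: C_def)
  have "C * (gw_series oo M) = (C * gw_series) oo M"
    by (simp add: fps_compose_mult_distrib M0 C_M)
  also have "\<dots> = C * gw_series"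
    by (simp add: CA fps_compose_uminus X2_M)
  finally have "C * (gw_series oo M) = C * gw_series" .
  moreover have "C \<noteq> 0" using CA by auto
  ultimately have "gw_series oo M = gw_series" by simp
  then have "fps_nth (gw_series oo M) n = fps_nth gw_series n" by simp
  then show ?thesis
    using assms by (simp add: M_def fps_compose_linear del: fps_const_neg)
qed

section \<open>Derivatives of polylogarithms\<close>

lemma summable_powi_power_series:
  fixes z :: complex
  assumes "norm z < 1"
  shows "summable (\<lambda>n. of_nat n powi s * z ^ n)"
proof (rule summable_in_conv_radius)
  have "(\<lambda>n. of_nat n / of_nat (Suc n) :: complex) \<longlonglongrightarrow> 1"
    by (rule LIMSEQ_n_over_Suc_n)
  then have "(\<lambda>n. (of_nat n / of_nat (Suc n) :: complex) powi s) \<longlonglongrightarrow> 1 powi s"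
    by (rule tendsto_power_int) simp
  then have lim: "(\<lambda>n. of_nat n powi s / of_nat (Suc n) powi s :: complex) \<longlonglongrightarrow> 1"
    by (simp add: power_int_divide_distrib)
  have "conv_radius (\<lambda>n. of_nat n powi s :: complex) = 1"
    using tendsto_norm[OF lim]
    by (intro conv_radius_ratio_limit_nonzero[where c = 1])
       (simp_all add: norm_divide one_ereal_def)
  then show "ereal (norm z) < conv_radius (\<lambda>n. of_nat n powi s :: complex)"
    using assms by (simp add: one_ereal_def)
qed

text \<open>
  Termwise differentiation multiplies the coefficient of \<open>z\<^sup>n\<close> by \<open>n\<close> (after the factor \<open>1/z\<close> is
  split off), which lowers the weight by one; this takes weights out of the positive range.
\<close>

lemma has_field_derivative_polylog:
  assumes "norm z < 1" "z \<noteq> 0"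
  shows "(polylog s has_field_derivative polylog (s - 1) z / z) (at z)"
proof -
  \<comment> \<open>The constant term is set to zero explicitly because \<open>0 powi (-s)\<close> is \<open>1\<close> for \<open>s = 0\<close>.\<close>
  define c where "c n = (if n = 0 then 0 else of_nat n powi (- s) :: complex)" for n :: nat
  have summ: "summable (\<lambda>n. c n * w ^ n)" if "norm w < 1" for w
    using summable_powi_power_series[OF that, of "- s"]
    by (subst (asm) summable_Suc_iff[symmetric], subst summable_Suc_iff[symmetric])
       (simp add: c_def)
  have polylog_eq: "(\<Sum>n. c n * w ^ n) = polylog s w" if "norm w < 1" for w
    using suminf_split_head[OF summ[OF that]]
    by (simp add: c_def polylog_def power_int_minus field_simps)
  have diffs_eq: "diffs c n * z ^ n = z ^ Suc n / of_nat (Suc n) powi (s - 1) / z" for n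
    using assms(2)
    by (simp add: diffs_def c_def power_int_diff power_int_minus field_simps del: of_nat_Suc)
  have summ': "summable (\<lambda>n. diffs c n * z ^ n)"
    using termdiff_converges[of z 1 c] assms(1) summ by simp
  have "summable (\<lambda>n. z * (diffs c n * z ^ n))"
    by (rule summable_mult[OF summ'])
  then have "summable (\<lambda>n. z ^ Suc n / of_nat (Suc n) powi (s - 1))"
    using assms(2) by (simp add: diffs_eq del: of_nat_Suc power_Suc)
  then have "(\<Sum>n. diffs c n * z ^ n) = polylog (s - 1) z / z"
    unfolding diffs_eq polylog_def by (rule suminf_divide)
  moreover have "((\<lambda>w. \<Sum>n. c n * w ^ n) has_field_derivative (\<Sum>n. diffs c n * z ^ n)) (at z)"
    using summ assms(1) by (intro termdiffs_strong'[where K = 1]) auto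
  ultimately have "((\<lambda>w. \<Sum>n. c n * w ^ n) has_field_derivative polylog (s - 1) z / z) (at z)"
    by simp
  then show ?thesis
    by (rule has_field_derivative_transform_within_open[where S = "ball 0 1"])
       (use assms polylog_eq in auto)
qed

definition polylog_exp :: "int \<Rightarrow> complex \<Rightarrow> complex" where
  "polylog_exp s t = polylog s (exp (2 * of_real pi * \<i> * t))"

lemma has_field_derivative_polylog_exp:
  assumes "Im t > 0"
  shows "(polylog_exp s has_field_derivative 2 * of_real pi * \<i> * polylog_exp (s - 1) t) (at t)"
proof -
  have "norm (exp (2 * of_real pi * \<i> * t)) < 1"
    using assms by simp
  note polylog = has_field_derivative_polylog[OF this exp_not_eq_zero]
  have "((\<lambda>t. exp (2 * of_real pi * \<i> * t)) has_field_derivative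
           exp (2 * of_real pi * \<i> * t) * (2 * of_real pi * \<i>)) (at t)"
    by (auto intro!: derivative_eq_intros)
  from DERIV_chain2[OF polylog this] show ?thesis
    unfolding polylog_exp_def by (simp add: mult_ac)
qed

lemma eventually_nhds_upper_half_plane:
  assumes "Im t > 0"
  shows "eventually (\<lambda>x. Im x > 0) (nhds t)"
  using eventually_nhds_in_open[OF open_halfspace_Im_gt[of 0], of t] assms by simp

lemma funpow_deriv_polylog_exp:
  assumes "Im t > 0"
  shows "(deriv ^^ k) (\<lambda>t. a * polylog_exp s t) t =
           a * (2 * of_real pi * \<i>) ^ k * polylog_exp (s - int k) t"
  using assms
proof (induction k arbitrary: t)
  case (Suc k)
  have "eventually (\<lambda>x. (deriv ^^ k) (\<lambda>t. a * polylog_exp s t) x =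
          a * (2 * of_real pi * \<i>) ^ k * polylog_exp (s - int k) x) (nhds t)"
    using eventually_nhds_upper_half_plane[OF Suc.prems]
    by eventually_elim (rule Suc.IH)
  then have "(deriv ^^ Suc k) (\<lambda>t. a * polylog_exp s t) t =
      deriv (\<lambda>x. a * (2 * of_real pi * \<i>) ^ k * polylog_exp (s - int k) x) t"
    by (simp add: deriv_cong_ev)
  also have "\<dots> = a * (2 * of_real pi * \<i>) ^ k *
      (2 * of_real pi * \<i> * polylog_exp (s - int k - 1) t)"
    by (intro DERIV_imp_deriv DERIV_cmult has_field_derivative_polylog_exp Suc.prems)
  finally show ?case
    by (simp add: algebra_simps)
qed simp

section \<open>The shifted potential\<close>

text \<open>
  For \<open>g \<ge> 1\<close> the factor \<open>1 / (2g (2g - 2)!)\<close> is \<open>(2g - 1) / (2g)!\<close>. In this form the sequence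
  continues correctly to genus zero, where the coefficient is \<open>1 = -(0 - 1) B\<^sub>0 / 0!\<close>.
\<close>

lemma GW_coeff_eq:
  "GW_coeff g = (\<lambda>t. fps_nth gw_series (2 * g) * polylog_exp (3 - 2 * int g) t)"
proof (cases g)
  case 0
  have "fps_nth ((fps_exp 1 - 1) * bernoulli_fps) 1 = 1"
    by (simp add: bernoulli_fps_egf)
  then have "bernoulli 0 = 1"
    by (simp add: fps_mult_nth_1 bernoulli_fps_def)
  then show ?thesis
    by (simp add: 0 fun_eq_iff GW_coeff_def gw_series_nth polylog_exp_def)
next
  case (Suc h)
  have f: "fact (2 * g) = (2 * of_nat g) * (2 * of_nat g - 1) * (fact (2 * g - 2) :: complex)"
    by (simp add: Suc algebra_simps)
  have "(2 * of_nat g - 1 :: complex) = of_nat (2 * h + 1)"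
    by (simp add: Suc)
  then have nz: "(2 * of_nat g - 1 :: complex) \<noteq> 0"
    by (metis of_nat_eq_0_iff add_is_0 one_neq_zero)
  have "fps_nth gw_series (2 * g) =
     (-1) ^ (g - 1) * of_real (bernoulli (2 * g)) * ((2 * of_nat g - 1) / fact (2 * g))"
    by (simp add: gw_series_nth Suc power_mult)
  also have "(2 * of_nat g - 1) / fact (2 * g) = 1 / (2 * of_nat g * fact (2 * g - 2) :: complex)"
    using nz unfolding f by (simp add: divide_simps)
  finally show ?thesis
    by (simp add: fun_eq_iff GW_coeff_def polylog_exp_def Suc)
qed

lemma GW_potential_nth_eq:
  "fls_nth GW_potential (int m - 2) = (\<lambda>t. fps_nth gw_series m * polylog_exp (3 - int m) t)"
proof (cases "even m")
  case True
  then obtain g where "m = 2 * g" by blast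
  then show ?thesis
    using GW_potential_nth(1)[of g] by (simp add: GW_coeff_eq)
next
  case False
  then show ?thesis
    by (simp add: GW_potential_nth(2) gw_series_odd zero_fun_def)
qed

lemma funpow_deriv_zero: "(deriv ^^ k) (0 :: complex \<Rightarrow> complex) = 0"
  by (induction k) (simp_all add: zero_fun_def)

text \<open>
  The number of derivatives is allowed to range over any finite set that covers the support of
  the coefficients, because the additional terms are derivatives of the zero function.
\<close>

lemma taylor_shift_nth_finite:
  assumes "finite K" "\<And>k. k \<notin> K \<Longrightarrow> fls_nth F (m - int k) = 0"
  shows "fls_nth (taylor_shift c F) m t =
           (\<Sum>k\<in>K. c ^ k / fact k * (deriv ^^ k) (fls_nth F (m - int k)) t)"
  unfolding taylor_shift_nth using assms
  by (intro sum.mono_neutral_left) (auto simp: funpow_deriv_zero)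

text \<open>
  The term with \<open>k\<close> derivatives starts from weight \<open>3 - (N - k)\<close> and so ends in weight
  \<open>3 - N\<close> for every \<open>k\<close>: the polylogarithm factors out and a Cauchy product of numerical
  series remains.
\<close>

lemma taylor_shift_GW_potential_nth:
  assumes "Im t > 0"
  shows "fls_nth (taylor_shift c GW_potential) (int N - 2) t =
           fps_nth (fps_exp (2 * of_real pi * \<i> * c) * gw_series) N * polylog_exp (3 - int N) t"
proof -
  have "fls_nth (taylor_shift c GW_potential) (int N - 2) t =
      (\<Sum>k\<le>N. c ^ k / fact k * (deriv ^^ k) (fls_nth GW_potential (int N - 2 - int k)) t)"
    by (rule taylor_shift_nth_finite) (auto intro: GW_potential_nth(3))
  also have "\<dots> = (\<Sum>k\<le>N. (2 * of_real pi * \<i> * c) ^ k / fact k * fps_nth gw_series (N - k) *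
      polylog_exp (3 - int N) t)"
  proof (intro sum.cong refl)
    fix k assume "k \<in> {..N}"
    then have idx: "int N - 2 - int k = int (N - k) - 2" "3 - int (N - k) - int k = 3 - int N"
      by auto
    show "c ^ k / fact k * (deriv ^^ k) (fls_nth GW_potential (int N - 2 - int k)) t =
        (2 * of_real pi * \<i> * c) ^ k / fact k * fps_nth gw_series (N - k) *
        polylog_exp (3 - int N) t"
      unfolding idx(1) GW_potential_nth_eq funpow_deriv_polylog_exp[OF assms] idx(2)
      by (simp add: power_mult_distrib)
  qed
  also have "\<dots> = fps_nth (fps_exp (2 * of_real pi * \<i> * c) * gw_series) N *
      polylog_exp (3 - int N) t"
    by (simp add: fps_mult_nth atLeast0AtMost sum_distrib_right)
  finally show ?thesis .
qed

lemma taylor_shift_GW_potential_nth_below: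
  "n < -2 \<Longrightarrow> fls_nth (taylor_shift c GW_potential) n t = 0"
  by (subst taylor_shift_nth_finite[of "{}"]) (auto intro: GW_potential_nth(3))

lemma second_derivative_genus_zero:
  assumes "Im t > 0"
  shows "((\<lambda>f s. 1 / (2 * of_real pi) * deriv f s) ^^ 2) (GW_coeff 0) t = - polylog_exp 1 t"
proof -
  have GW0: "GW_coeff 0 = polylog_exp 3"
    by (simp add: fun_eq_iff GW_coeff_def polylog_exp_def)
  have inner: "1 / (2 * of_real pi) * deriv (polylog_exp 3) s = \<i> * polylog_exp 2 s"
    if "Im s > 0" for s
    using DERIV_imp_deriv[OF has_field_derivative_polylog_exp[OF that, of 3]] by simp
  have "deriv (\<lambda>s. 1 / (2 * of_real pi) * deriv (polylog_exp 3) s) t =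
      deriv (\<lambda>s. \<i> * polylog_exp 2 s) t"
    by (intro deriv_cong_ev refl eventually_mono[OF eventually_nhds_upper_half_plane[OF assms]] inner)
  also have "\<dots> = \<i> * (2 * of_real pi * \<i> * polylog_exp (2 - 1) t)"
    by (intro DERIV_imp_deriv DERIV_cmult has_field_derivative_polylog_exp assms)
  finally show ?thesis
    by (simp add: GW0 numeral_2_eq_2)
qed

lemma fls_nth_double:
  "fls_nth (2 * F) n t = 2 * fls_nth F n t" for F :: "(complex \<Rightarrow> complex) fls"
  by (subst mult_2) simp

theorem theorem1:
  fixes n :: int and t :: complex
  assumes "Im t > 0"
  shows "fls_nth (taylor_shift (1 / (2 * of_real pi)) GW_potential
                    - 2 * GW_potential
                    + taylor_shift (- (1 / (2 * of_real pi))) GW_potential) n t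
       = fls_nth (fls_const (((\<lambda>f s. 1 / (2 * of_real pi) * deriv f s) ^^ 2) (GW_coeff 0))) n t"
proof (cases "n < -2")
  case True
  then show ?thesis
    by (simp add: fls_nth_double taylor_shift_GW_potential_nth_below GW_potential_nth(3))
next
  case False
  define N where "N = nat (n + 2)"
  have n: "n = int N - 2"
    using False by (simp add: N_def)
  have "fls_nth (taylor_shift (1 / (2 * of_real pi)) GW_potential - 2 * GW_potential
          + taylor_shift (- (1 / (2 * of_real pi))) GW_potential) n t =
        fps_nth ((fps_exp \<i> + fps_exp (- \<i>) - 2) * gw_series) N * polylog_exp (3 - int N) t"
    unfolding n
    by (simp add: fls_nth_double taylor_shift_GW_potential_nth[OF assms] GW_potential_nth_eq
          ring_distribs)
  also have "\<dots> = (if N = 2 then - polylog_exp 1 t else 0)"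
    by (simp add: gw_series_functional_equation fps_X_power_nth)
  also have "\<dots> = fls_nth (fls_const
      (((\<lambda>f s. 1 / (2 * of_real pi) * deriv f s) ^^ 2) (GW_coeff 0))) n t"
    using second_derivative_genus_zero[OF assms] by (simp add: n)
  finally show ?thesis .
qed

end
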